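(* Let $R$ be a commutative ring with unity, let $\{a_{n}\}_{n\ge 0}$ be a sequence of elements of $R$ such that $a_{0}$ is invertible, let $S=\sum_{i\geq 0}a_{i}X^{i}\in R[[X]]$, and for each integer $k$ write $S^{k}=\sum_{i\geq 0}\mathbf{a}_{i}^{(k)}X^{i}$. Then for every integer $k$ and every $n\ge 1$, $$n\,\mathbf{a}_{n}^{(k)}=k\sum_{i=1}^{n}i\,a_{i}\,\mathbf{a}_{n-i}^{(k-1)}.$$
   Context: Since $a_0$ is invertible, $S$ is invertible in $R[[X]]$ and $S^k$ is defined for every integer $k$, possibly negative. *)

theory Defs
  imports "HOL-Computational_Algebra.Formal_Power_Series"
begin

text \<open>
  The library's \<open>inverse\<close> and \<open>powi\<close> on formal power series presuppose an \<open>inverse\<close> operation on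
  the coefficients, which a commutative ring does not carry. Hence the inverse of a unit
  and its integer powers are defined here for an arbitrary commutative ring; they are meaningful
  only for units (negative powers of a non-unit are unspecified).
\<close>

definition unit_inv :: "'a::comm_ring_1 \<Rightarrow> 'a" where
  "unit_inv x = (THE y. x * y = 1)"

definition unit_powi :: "'a::comm_ring_1 \<Rightarrow> int \<Rightarrow> 'a" where
  "unit_powi x k = (if k \<ge> 0 then x ^ nat k else unit_inv x ^ nat (- k))"

lemma unit_inv_unique:
  fixes x y :: "'a::comm_ring_1"
  assumes "x * y = 1"
  shows "unit_inv x = y"
  unfolding unit_inv_def
proof (rule the_equality)
  show "x * y = 1" by (fact assms)
next
  fix z assume "x * z = 1"
  then show "z = y"
    by (metis assms mult.assoc mult.commute mult_1_left)
qed

lemma unit_inv_right: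
  fixes x :: "'a::comm_ring_1"
  assumes "x dvd 1"
  shows "x * unit_inv x = 1"
  using assms by (metis dvdE unit_inv_unique)

lemma fps_dvd_one_iff:
  fixes S :: "'a::comm_ring_1 fps"
  shows "S dvd 1 \<longleftrightarrow> fps_nth S 0 dvd 1"
proof
  assume "S dvd 1"
  then obtain T where "1 = S * T" by (elim dvdE)
  then have "fps_nth S 0 * fps_nth T 0 = 1"
    by (metis fps_mult_nth_0 fps_one_nth)
  then show "fps_nth S 0 dvd 1" by (metis dvd_triv_left)
next
  assume "fps_nth S 0 dvd 1"
  then obtain y where "fps_nth S 0 * y = 1" by (metis dvdE)
  then have "S * fps_right_inverse S y = 1" by (rule fps_right_inverse)
  then show "S dvd 1" by (metis dvd_triv_left)
qed

end

theory Submission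
  imports Defs
begin

text \<open>
  The recurrence is the power rule \<open>(S\<^bsup>k\<^esup>)' = k S' S\<^bsup>k-1\<^esup>\<close>, compared at the coefficient of
  \<open>X\<^bsup>n-1\<^esup>\<close>: on the left this coefficient is \<open>n\<close> times the \<open>n\<close>-th coefficient of \<open>S\<^bsup>k\<^esup>\<close>, and on the
  right the Cauchy product of \<open>S'\<close> with \<open>S\<^bsup>k-1\<^esup>\<close> is the sum over \<open>i\<close>. Formal differentiation never
  divides, so the identity holds in every characteristic.

  For \<open>k \<ge> 0\<close> the power rule is the ordinary one. For \<open>k < 0\<close>, put \<open>T = S\<^bsup>-1\<^esup>\<close>: differentiating
  \<open>S T = 1\<close> gives \<open>T' = - S' T\<^sup>2\<close> (\<open>fps_deriv_unit_inv\<close>), and the ordinary power rule for the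
  positive power \<open>T\<^bsup>-k\<^esup>\<close> yields the rule for \<open>S\<^bsup>k\<^esup>\<close> (\<open>fps_deriv_unit_powi\<close>).
\<close>

text \<open>
  Differentiating \<open>S T = 1\<close> gives only \<open>S T' = - S' T\<close>; multiplying by \<open>T\<close> cancels the factor \<open>S\<close>.
\<close>

lemma fps_deriv_unit_inv:
  fixes S :: "'a::comm_ring_1 fps"
  assumes "S dvd 1"
  shows "fps_deriv (unit_inv S) = - fps_deriv S * unit_inv S ^ 2"
proof -
  define T where "T = unit_inv S"
  have ST: "S * T = 1"
    unfolding T_def using assms by (rule unit_inv_right)
  have "S * fps_deriv T + fps_deriv S * T = 0"
    using arg_cong[OF ST, of fps_deriv] by simp
  then have "S * fps_deriv T = - (fps_deriv S * T)"
    by (simp add: eq_neg_iff_add_eq_0)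
  then have "T * (S * fps_deriv T) = T * - (fps_deriv S * T)"
    by (rule arg_cong)
  then have "(S * T) * fps_deriv T = - fps_deriv S * T ^ 2"
    by (simp add: power2_eq_square ac_simps)
  then show ?thesis
    by (simp add: ST flip: T_def)
qed

lemma fps_deriv_unit_powi:
  fixes S :: "'a::comm_ring_1 fps"
  assumes "S dvd 1"
  shows "fps_deriv (unit_powi S k) = of_int k * fps_deriv S * unit_powi S (k - 1)"
proof (cases k "0::int" rule: linorder_cases)
  case greater
  then have "nat (k - 1) = nat k - 1" by simp
  with greater show ?thesis
    by (simp add: unit_powi_def fps_deriv_power')
next
  case equal
  then show ?thesis by (simp add: unit_powi_def)
next
  case less
  then obtain m where k: "k = - int (Suc m)"
    by (metis negD)
  have exponents: "nat (- k) = Suc m" "nat (- (k - 1)) = Suc (Suc m)"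
    using k by simp_all
  have "fps_deriv (unit_inv S ^ Suc m)
      = of_nat (Suc m) * (- fps_deriv S * unit_inv S ^ 2) * unit_inv S ^ m"
    by (simp only: fps_deriv_power' fps_deriv_unit_inv[OF assms] diff_Suc_1)
  also have "\<dots> = of_int k * fps_deriv S * unit_inv S ^ Suc (Suc m)"
    by (simp add: k power2_eq_square algebra_simps)
  finally show ?thesis
    using less by (simp only: unit_powi_def exponents) simp
qed

theorem theorem1p10:
  fixes a :: "nat \<Rightarrow> 'a::comm_ring_1" and k :: int and n :: nat
  assumes "a 0 dvd 1" and "n \<ge> 1"
  shows "of_nat n * fps_nth (unit_powi (Abs_fps a) k) n =
    of_int k * (\<Sum>i=1..n. of_nat i * a i * fps_nth (unit_powi (Abs_fps a) (k - 1)) (n - i))"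
proof -
  define S where "S = Abs_fps a"
  have unit: "S dvd 1"
    using assms(1) by (simp add: S_def fps_dvd_one_iff)
  obtain m where n: "n = Suc m"
    using assms(2) by (metis Suc_le_D One_nat_def)
  have "of_nat n * fps_nth (unit_powi S k) n = fps_nth (fps_deriv (unit_powi S k)) m"
    by (simp add: n)
  also have "\<dots> = of_int k * fps_nth (fps_deriv S * unit_powi S (k - 1)) m"
    by (simp add: fps_deriv_unit_powi[OF unit] mult.assoc flip: fps_of_int)
  also have "fps_nth (fps_deriv S * unit_powi S (k - 1)) m
      = (\<Sum>j=0..m. of_nat (Suc j) * a (Suc j) * fps_nth (unit_powi S (k - 1)) (n - Suc j))"
    by (simp add: fps_mult_nth S_def n)
  also have "\<dots> = (\<Sum>i=1..n. of_nat i * a i * fps_nth (unit_powi S (k - 1)) (n - i))"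
    unfolding n One_nat_def by (rule sum.shift_bounds_cl_Suc_ivl[symmetric])
  finally show ?thesis
    by (simp only: S_def)
qed

end
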